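(* Let $Q\in\mathbb{R}^{n\times n}$ be symmetric with $\lambda_Q<0$, let $g\in\mathbb{R}^n$ and let $l\in\mathbb{R}$ with $l\le 1$. Then an exact convex reformulation of the interval-bounded trust-region subproblem $$\min_y\{y^\top Qy+2g^\top y:\ l\le\|y\|\le 1\}$$ is given by $$\min_y\{y^\top(Q-\lambda_Q I_n)y+2g^\top y+\lambda_Q:\ \|y\|\le 1\},$$ i.e. the two optimal values are equal.
   Context: $\|\cdot\|$ is the Euclidean norm on $\mathbb{R}^n$, $y$ ranges over $\mathbb{R}^n$, and $\lambda_Q:=\lambda_{\min}(Q)$ is the minimum eigenvalue of $Q$. *)

theory Defs
  imports "HOL-Analysis.Analysis"
begin

definition eigenvalue :: "real ^ 'n ^ 'n \<Rightarrow> real \<Rightarrow> bool" where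
  "eigenvalue A \<mu> \<longleftrightarrow> (\<exists>v. v \<noteq> 0 \<and> A *v v = \<mu> *\<^sub>R v)"

(* Meaningful for symmetric A: then all eigenvalues are real, and the set below is
   finite and nonempty. *)
definition lambda_min :: "real ^ 'n ^ 'n \<Rightarrow> real" where
  "lambda_min A = Min {\<mu>. eigenvalue A \<mu>}"

(* The problem "min f over S" has optimal value m; the minimum has to be attained. *)
definition is_min_value :: "('a \<Rightarrow> real) \<Rightarrow> 'a set \<Rightarrow> real \<Rightarrow> bool" where
  "is_min_value f S m \<longleftrightarrow> (\<exists>y. is_arg_min f (\<lambda>x. x \<in> S) y \<and> f y = m)"

end

theory Submission
  imports Defs
begin

text \<open>
  On the unit ball the second objective lies below the first, since they differ by
  \<open>lambda_min Q * (1 - (norm y)\<^sup>2)\<close>, and they agree on the unit sphere. The second objective is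
  affine along an eigenvector for \<open>lambda_min Q\<close>; following that eigenvector in the direction
  in which \<open>g\<close> does not increase, any minimizer in the ball can be moved to the sphere.
\<close>

lemma inner_matrix_vector_symmetric:
  fixes A :: "real ^ 'n ^ 'n"
  assumes "transpose A = A"
  shows "x \<bullet> (A *v y) = (A *v x) \<bullet> y"
  by (metis assms dot_lmul_matrix transpose_matrix_vector)

lemma shift_matrix_vector:
  fixes A :: "real ^ 'n ^ 'n"
  shows "(A - c *\<^sub>R mat 1) *v x = A *v x - c *\<^sub>R x"
  by (simp add: matrix_vector_mult_diff_rdistrib flip: scaleR_matrix_vector_assoc)

lemma transpose_shift:
  fixes A :: "real ^ 'n ^ 'n"
  assumes "transpose A = A"
  shows "transpose (A - c *\<^sub>R mat 1) = A - c *\<^sub>R mat 1"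
  using assms by (auto simp: transpose_def mat_def vec_eq_iff)

text \<open>This exact expansion serves three purposes: the perturbation argument for kernels,
  convexity along segments, and affinity along a kernel direction.\<close>

lemma quadratic_form_line:
  fixes A :: "real ^ 'n ^ 'n"
  assumes "transpose A = A"
  shows "(x + t *\<^sub>R h) \<bullet> (A *v (x + t *\<^sub>R h))
    = x \<bullet> (A *v x) + 2 * t * (h \<bullet> (A *v x)) + t\<^sup>2 * (h \<bullet> (A *v h))"
proof -
  have "x \<bullet> (A *v h) = h \<bullet> (A *v x)"
    using inner_matrix_vector_symmetric[OF assms, of x h] by (simp add: inner_commute)
  then show ?thesis
    by (simp add: matrix_vector_right_distrib matrix_vector_mult_scaleR inner_add_left
        inner_add_right power2_eq_square algebra_simps)
qed

text \<open>At a zero of a nonnegative form the first-order term must vanish in every direction. In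
  the direction \<open>A *v v\<close> that term is twice the squared norm of \<open>A *v v\<close>;
  were it positive, a suitable negative step would make the form negative.\<close>

lemma psd_form_zero_imp_kernel:
  fixes A :: "real ^ 'n ^ 'n"
  assumes sym: "transpose A = A" and psd: "\<And>x. 0 \<le> x \<bullet> (A *v x)"
    and zero: "v \<bullet> (A *v v) = 0"
  shows "A *v v = 0"
proof (rule ccontr)
  define h where "h = A *v v"
  define a where "a = h \<bullet> h"
  define b where "b = h \<bullet> (A *v h)"
  assume "A *v v \<noteq> 0"
  then have a: "a > 0" by (simp add: a_def h_def)
  have b: "b \<ge> 0" using psd by (simp add: b_def)
  \<comment> \<open>For \<open>b > 0\<close> the quadratic in \<open>t\<close> is smallest at
    \<open>- a / b\<close>; the denominator \<open>b + 1\<close> also covers \<open>b = 0\<close>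
    and still yields a negative value.\<close>
  define t where "t = - a / (b + 1)"
  have "0 \<le> 2 * t * a + t\<^sup>2 * b"
    using psd[of "v + t *\<^sub>R h"] quadratic_form_line[OF sym, of v t h] zero
    by (simp add: a_def b_def h_def)
  also have "\<dots> = - a\<^sup>2 * (b + 2) / (b + 1)\<^sup>2"
  proof -
    define c where "c = b + 1"
    have "c > 0" and b_c: "b = c - 1" using b by (simp_all add: c_def)
    then show ?thesis unfolding t_def b_c by (simp add: field_simps power2_eq_square)
  qed
  also have "\<dots> < 0"
    using a b by (simp add: divide_neg_pos mult_pos_pos)
  finally show False by simp
qed

text \<open>By compactness the form attains a minimum on the unit sphere. Shifting \<open>A\<close>
  by that value gives a nonnegative form that vanishes at the minimizer, which therefore lies in the
  kernel of the shifted matrix.\<close>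

lemma symmetric_rayleigh_minimum:
  fixes A :: "real ^ 'n ^ 'n"
  assumes sym: "transpose A = A"
  obtains \<mu> where "eigenvalue A \<mu>" "\<And>x. \<mu> * (x \<bullet> x) \<le> x \<bullet> (A *v x)"
proof -
  have "continuous_on (sphere 0 1) (\<lambda>x. x \<bullet> (A *v x))"
    by (intro continuous_intros matrix_vector_mult_linear_continuous_on)
  then obtain v where v: "norm v = 1"
    and vmin: "\<And>x. norm x = 1 \<Longrightarrow> v \<bullet> (A *v v) \<le> x \<bullet> (A *v x)"
    using continuous_attains_inf[of "sphere (0 :: real ^ 'n) 1" "\<lambda>x. x \<bullet> (A *v x)"] by auto
  define \<mu> where "\<mu> = v \<bullet> (A *v v)"
  define M where "M = A - \<mu> *\<^sub>R mat 1"
  have bound: "\<mu> * (x \<bullet> x) \<le> x \<bullet> (A *v x)" for x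
  proof (cases "x = 0")
    case False
    \<comment> \<open>The form is homogeneous of degree two, so normalizing \<open>x\<close> carries
      the bound from the sphere to all nonzero vectors.\<close>
    then have "\<mu> \<le> (x /\<^sub>R norm x) \<bullet> (A *v (x /\<^sub>R norm x))"
      unfolding \<mu>_def by (intro vmin) simp
    also have "\<dots> = (x \<bullet> (A *v x)) / (x \<bullet> x)"
      by (simp add: matrix_vector_mult_scaleR dot_square_norm power2_eq_square field_simps)
    finally show ?thesis
      using False by (simp add: pos_le_divide_eq)
  qed simp
  have "M *v v = 0"
  proof (rule psd_form_zero_imp_kernel)
    show "transpose M = M" using transpose_shift[OF sym] by (simp add: M_def)
    show "0 \<le> x \<bullet> (M *v x)" for x
      using bound[of x] by (simp add: M_def shift_matrix_vector inner_diff_right)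
    show "v \<bullet> (M *v v) = 0"
      using v by (simp add: M_def shift_matrix_vector inner_diff_right \<mu>_def dot_square_norm)
  qed
  then have "eigenvalue A \<mu>"
    unfolding eigenvalue_def using v
    by (intro exI[of _ v]) (auto simp: M_def shift_matrix_vector)
  then show thesis using bound that by blast
qed

text \<open>Eigenvectors for distinct eigenvalues are orthogonal, and a pairwise orthogonal set in
  finite dimension is finite. Choosing one eigenvector per eigenvalue transfers this to the
  spectrum, so that \<open>Min\<close> in \<open>lambda_min\<close> is meaningful.\<close>

lemma finite_eigenvalues_symmetric:
  fixes A :: "real ^ 'n ^ 'n"
  assumes sym: "transpose A = A"
  shows "finite {\<mu>. eigenvalue A \<mu>}"
proof -
  have "\<forall>\<mu>. \<exists>v. eigenvalue A \<mu> \<longrightarrow> v \<noteq> 0 \<and> A *v v = \<mu> *\<^sub>R v"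
    unfolding eigenvalue_def by auto
  from choice[OF this] obtain e
    where e: "\<And>\<mu>. eigenvalue A \<mu> \<Longrightarrow> e \<mu> \<noteq> 0 \<and> A *v e \<mu> = \<mu> *\<^sub>R e \<mu>"
    by blast
  have orth: "e \<mu> \<bullet> e \<nu> = 0" if "eigenvalue A \<mu>" "eigenvalue A \<nu>" "\<mu> \<noteq> \<nu>" for \<mu> \<nu>
    using inner_matrix_vector_symmetric[OF sym, of "e \<mu>" "e \<nu>"] e that by simp
  have "inj_on e {\<mu>. eigenvalue A \<mu>}"
  proof (rule inj_onI, rule ccontr)
    fix \<mu> \<nu> assume "\<mu> \<in> {\<mu>. eigenvalue A \<mu>}" "\<nu> \<in> {\<mu>. eigenvalue A \<mu>}"
      and "e \<mu> = e \<nu>" "\<mu> \<noteq> \<nu>"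
    \<comment> \<open>A shared eigenvector would be orthogonal to itself, hence zero.\<close>
    then show False using orth[of \<mu> \<nu>] e[of \<nu>] by simp
  qed
  moreover have "finite (e ` {\<mu>. eigenvalue A \<mu>})"
    by (rule pairwise_orthogonal_imp_finite)
      (auto simp: pairwise_def orthogonal_def intro!: orth)
  ultimately show ?thesis by (rule finite_imageD[rotated])
qed

text \<open>The Rayleigh minimum is itself an eigenvalue, so \<open>lambda_min A\<close> lies below
  it and inherits its lower bound on the form.\<close>

lemma lambda_min_symmetric:
  fixes A :: "real ^ 'n ^ 'n"
  assumes sym: "transpose A = A"
  shows "eigenvalue A (lambda_min A)"
    and "lambda_min A * (x \<bullet> x) \<le> x \<bullet> (A *v x)"
proof -
  obtain \<mu> where \<mu>: "eigenvalue A \<mu>" "\<And>x. \<mu> * (x \<bullet> x) \<le> x \<bullet> (A *v x)"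
    using symmetric_rayleigh_minimum[OF sym] by blast
  have fin: "finite {\<mu>. eigenvalue A \<mu>}"
    by (rule finite_eigenvalues_symmetric[OF sym])
  then show "eigenvalue A (lambda_min A)"
    using Min_in[OF fin] \<mu>(1) by (auto simp: lambda_min_def)
  have "lambda_min A \<le> \<mu>"
    unfolding lambda_min_def using fin \<mu>(1) by simp
  then have "lambda_min A * (x \<bullet> x) \<le> \<mu> * (x \<bullet> x)"
    by (simp add: mult_right_mono)
  with \<mu>(2) show "lambda_min A * (x \<bullet> x) \<le> x \<bullet> (A *v x)"
    by (rule order_trans[rotated])
qed

text \<open>On a segment with direction \<open>h\<close> the chord exceeds the function by
  \<open>t * (1 - t) * (h \<bullet> (A *v h))\<close>.\<close>

lemma convex_on_psd_quadratic:
  fixes A :: "real ^ 'n ^ 'n"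
  assumes sym: "transpose A = A" and psd: "\<And>x. 0 \<le> x \<bullet> (A *v x)" and "convex S"
  shows "convex_on S (\<lambda>y. y \<bullet> (A *v y) + 2 * (g \<bullet> y) + c)"
proof (rule convex_onI)
  fix t :: real and x y :: "real ^ 'n" assume t: "0 < t" "t < 1"
  define h where "h = y - x"
  have y: "y = x + 1 *\<^sub>R h" and z: "(1 - t) *\<^sub>R x + t *\<^sub>R y = x + t *\<^sub>R h"
    by (simp_all add: h_def algebra_simps)
  have "t\<^sup>2 * (h \<bullet> (A *v h)) \<le> t * (h \<bullet> (A *v h))"
    using t psd[of h] by (intro mult_right_mono) (simp_all add: power2_eq_square)
  then show "((1 - t) *\<^sub>R x + t *\<^sub>R y) \<bullet> (A *v ((1 - t) *\<^sub>R x + t *\<^sub>R y))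
      + 2 * (g \<bullet> ((1 - t) *\<^sub>R x + t *\<^sub>R y)) + c
    \<le> (1 - t) * (x \<bullet> (A *v x) + 2 * (g \<bullet> x) + c) + t * (y \<bullet> (A *v y) + 2 * (g \<bullet> y) + c)"
    unfolding z unfolding y quadratic_form_line[OF sym]
    by (simp add: inner_add_right algebra_simps)
qed fact

lemma ray_meets_unit_sphere:
  fixes y v :: "'a :: real_normed_vector"
  assumes y: "norm y \<le> 1" and v: "v \<noteq> 0"
  obtains t where "0 \<le> t" "norm (y + t *\<^sub>R v) = 1"
proof -
  \<comment> \<open>A step of length 2 from a point of the unit ball ends at norm at least 1, so the
    intermediate value theorem applies on \<open>{0..T}\<close>.\<close>
  define T where "T = 2 / norm v"
  have "norm (T *\<^sub>R v) = 2" using v by (simp add: T_def)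
  then have "1 \<le> norm (y + T *\<^sub>R v)"
    using norm_diff_ineq[of "T *\<^sub>R v" y] y by (simp add: add.commute)
  moreover have "continuous_on {0..T} (\<lambda>t. norm (y + t *\<^sub>R v))"
    by (intro continuous_intros)
  moreover have "0 \<le> T" by (simp add: T_def)
  ultimately show thesis
    using IVT'[of "\<lambda>t. norm (y + t *\<^sub>R v)" 0 1 T] y that by auto
qed

theorem corollary18:
  fixes Q :: "real ^ 'n ^ 'n" and g :: "real ^ 'n" and l :: real
  assumes "transpose Q = Q"
    and "lambda_min Q < 0"
    and "l \<le> 1"
  shows "convex_on {y. norm y \<le> 1}
           (\<lambda>y. y \<bullet> ((Q - lambda_min Q *\<^sub>R mat 1) *v y) + 2 * (g \<bullet> y) + lambda_min Q)
       \<and> (\<exists>m. is_min_value (\<lambda>y. y \<bullet> (Q *v y) + 2 * (g \<bullet> y)) {y. l \<le> norm y \<and> norm y \<le> 1} m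
            \<and> is_min_value
                (\<lambda>y. y \<bullet> ((Q - lambda_min Q *\<^sub>R mat 1) *v y) + 2 * (g \<bullet> y) + lambda_min Q)
                {y. norm y \<le> 1} m)"
proof -
  define \<mu> where "\<mu> = lambda_min Q"
  define M where "M = Q - \<mu> *\<^sub>R mat 1"
  define f where "f = (\<lambda>y. y \<bullet> (Q *v y) + 2 * (g \<bullet> y))"
  define F where "F = (\<lambda>y. y \<bullet> (M *v y) + 2 * (g \<bullet> y) + \<mu>)"
  have sym: "transpose M = M"
    unfolding M_def by (rule transpose_shift[OF assms(1)])
  have psd: "0 \<le> x \<bullet> (M *v x)" for x
    using lambda_min_symmetric(2)[OF assms(1), of x]
    by (simp add: M_def \<mu>_def shift_matrix_vector inner_diff_right)
  have ball: "{y :: real ^ 'n. norm y \<le> 1} = cball 0 1" by auto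
  have convex: "convex_on {y. norm y \<le> 1} F"
    unfolding F_def ball by (intro convex_on_psd_quadratic sym psd convex_cball)
  have F_f: "F y = f y + \<mu> * (1 - (norm y)\<^sup>2)" for y
    unfolding F_def f_def M_def shift_matrix_vector
    by (simp add: inner_diff_right dot_square_norm algebra_simps)
  have F_le: "F y \<le> f y" if "norm y \<le> 1" for y
  proof -
    have "\<mu> * (1 - (norm y)\<^sup>2) \<le> 0"
      using assms(2) that by (intro mult_nonpos_nonneg) (auto simp: \<mu>_def power_le_one)
    then show ?thesis using F_f[of y] by simp
  qed
  obtain w where "w \<noteq> 0" "M *v w = 0"
    using lambda_min_symmetric(1)[OF assms(1)]
    by (auto simp: eigenvalue_def M_def \<mu>_def shift_matrix_vector)
  \<comment> \<open>The kernel is closed under negation, so the sign of the eigenvector can be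
    chosen to make its product with \<open>g\<close> nonpositive.\<close>
  moreover have "M *v (- w) = - (M *v w)"
    using matrix_vector_mult_scaleR[of M "-1" w] by simp
  ultimately obtain v where v: "v \<noteq> 0" "M *v v = 0" "g \<bullet> v \<le> 0"
    using that[of w] that[of "- w"] by (cases "g \<bullet> w \<le> 0") auto
  have "continuous_on (cball 0 1) F"
    unfolding F_def by (intro continuous_intros matrix_vector_mult_linear_continuous_on)
  then obtain y where y: "norm y \<le> 1" and ymin: "\<And>x. norm x \<le> 1 \<Longrightarrow> F y \<le> F x"
    using continuous_attains_inf[of "cball (0 :: real ^ 'n) 1" F] by auto
  obtain t where t: "0 \<le> t" and nz: "norm (y + t *\<^sub>R v) = 1"
    using ray_meets_unit_sphere[OF y v(1)] by blast
  define z where "z = y + t *\<^sub>R v"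
  \<comment> \<open>Symmetry moves \<open>M\<close> onto the kernel vector \<open>v\<close>, so the
    mixed term vanishes along with the second-order term and only the linear part in
    \<open>g\<close> remains.\<close>
  have "v \<bullet> (M *v y) = 0"
    using inner_matrix_vector_symmetric[OF sym, of v y] v(2) by simp
  then have "F z = F y + 2 * (t * (g \<bullet> v))"
    unfolding F_def z_def quadratic_form_line[OF sym] using v(2)
    by (simp add: inner_add_right)
  moreover have "t * (g \<bullet> v) \<le> 0" using t v(3) by (rule mult_nonneg_nonpos)
  ultimately have zmin: "F z \<le> F x" if "norm x \<le> 1" for x
    using ymin[OF that] by simp
  have z: "norm z = 1" and f_z: "f z = F z" using nz F_f[of z] by (simp_all add: z_def)
  \<comment> \<open>The point \<open>z\<close> is feasible since \<open>l \<le> 1\<close>, and every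
    feasible \<open>x\<close> satisfies \<open>f z = F z \<le> F x \<le> f x\<close>.\<close>
  have "is_min_value f {y. l \<le> norm y \<and> norm y \<le> 1} (F z)"
    unfolding is_min_value_def is_arg_min_def
    using z f_z assms(3) zmin F_le by (intro exI[of _ z]) (force simp: not_less)
  moreover have "is_min_value F {y. norm y \<le> 1} (F z)"
    unfolding is_min_value_def is_arg_min_def
    using z zmin by (intro exI[of _ z]) (force simp: not_less)
  ultimately show ?thesis
    using convex unfolding f_def F_def M_def \<mu>_def by (intro conjI exI)
qed

end
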